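(* Let $n\ge2$ and $2\le m\le 2n-1$ be integers, and let $f_1,\ldots,f_m\in\mathbb{C}[z_1,\ldots,z_n]$ be weighted homogeneous polynomials with weights $w_{f_1},\ldots,w_{f_m}$, respectively. Suppose that $w_{f_j}=s_jw_{f_1}$ for some positive integer $s_j$, for $j=1,2,\ldots,m$. For every sufficiently small $\varepsilon>0$, if $p\in S_\varepsilon\setminus K_{f_1f_2\cdots f_m}$ is a singular point of the Milnor fibration product map $\Phi:S_\varepsilon\setminus K_{f_1f_2\cdots f_m}\to T^m$ associated with $f_1,\ldots,f_m$, then the $m$ vectors $$i\,\mathrm{grad}\log f_1(p),\ \ldots,\ i\,\mathrm{grad}\log f_m(p)$$ are linearly dependent over $\mathbb{C}$.
   Context: Weighted homogeneous: $f\in\mathbb{C}[z_1,\ldots,z_n]$ is weighted homogeneous with weights $w_f=(w_1,\ldots,w_n)$, a sequence of positive rational numbers, if $\sum_{j=1}^n \frac{z_j}{w_j}\frac{\partial f}{\partial z_j}=f$. The equation $w_{f_j}=s_j w_{f_1}$ is entrywise scalar multiplication. $S_\varepsilon=\{z\in\mathbb{C}^n\mid \|z\|=\varepsilon\}$ and $K_{f_1\cdots f_m}=\{z\in S_\varepsilon\mid f_1(z)\cdots f_m(z)=0\}$. The Milnor fibration product map associated with $f_1,\ldots,f_m$ is the $C^\infty$ map $\Phi:S_\varepsilon\setminus K_{f_1\cdots f_m}\to (S^1)^m=T^m$, $\Phi(z)=\left(\frac{f_1(z)}{|f_1(z)|},\ldots,\frac{f_m(z)}{|f_m(z)|}\right)$.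 A point $p$ is a singular point of $\Phi$ if $\mathrm{rank}\,d\Phi_p<m$. "For every sufficiently small $\varepsilon>0$" means: there is $\varepsilon_0>0$ (depending on the $f_j$) such that the assertion holds for all $0<\varepsilon\le\varepsilon_0$. For holomorphic $h$, $\mathrm{grad}\,h=\left(\overline{\partial h/\partial z_1},\ldots,\overline{\partial h/\partial z_n}\right)$; thus $\mathrm{grad}\log f_j(p)$ has $k$-th entry $\overline{\frac{1}{f_j(p)}\frac{\partial f_j}{\partial z_k}(p)}$. Linear dependence of a list of vectors refers to the indexed family (repetitions count as dependence). *)

theory Defs
  imports "HOL-Analysis.Analysis" "HOL-Library.Poly_Mapping"
begin

(* A polynomial in the variables z_k (k ranging over the finite type 'n) is a finitely
   supported map from exponent vectors to coefficients. *)
type_synonym 'n cpoly = "('n \<Rightarrow>\<^sub>0 nat) \<Rightarrow>\<^sub>0 complex"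

definition peval :: "'n::finite cpoly \<Rightarrow> complex ^ 'n \<Rightarrow> complex" where
  "peval f z = (\<Sum>a\<in>Poly_Mapping.keys f.
      Poly_Mapping.lookup f a * (\<Prod>k\<in>UNIV. (z $ k) ^ Poly_Mapping.lookup a k))"

definition partial_deriv ::
  "'n::finite \<Rightarrow> (complex ^ 'n \<Rightarrow> complex) \<Rightarrow> complex ^ 'n \<Rightarrow> complex" where
  "partial_deriv k h z = deriv (\<lambda>t. h (\<chi> i. if i = k then t else z $ i)) (z $ k)"

definition weighted_homogeneous :: "'n::finite cpoly \<Rightarrow> rat ^ 'n \<Rightarrow> bool" where
  "weighted_homogeneous f w \<longleftrightarrow>
     (\<forall>k. w $ k > 0) \<and>
     (\<forall>z. (\<Sum>k\<in>UNIV. z $ k / of_rat (w $ k) * partial_deriv k (peval f) z) = peval f z)"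

definition link :: "('m::finite \<Rightarrow> 'n::finite cpoly) \<Rightarrow> real \<Rightarrow> (complex ^ 'n) set" where
  "link f \<epsilon> = {z \<in> sphere 0 \<epsilon>. (\<Prod>j\<in>UNIV. peval (f j) z) = 0}"

(* The formula for the map to the torus (S^1)^m, here a subset of complex ^ 'm.  It is
   meaningful on the open set where no f j vanishes; the Milnor fibration product map is
   its restriction to sphere 0 \<epsilon> - link f \<epsilon>. *)
definition milnor_map :: "('m::finite \<Rightarrow> 'n::finite cpoly) \<Rightarrow> complex ^ 'n \<Rightarrow> complex ^ 'm" where
  "milnor_map f z = (\<chi> j. peval (f j) z / of_real (cmod (peval (f j) z)))"

(* Real tangent space at p of the sphere about 0 through p; the inner product is the real
   one, Re of the Hermitian product.  See sphere_tangent_iff. *)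
definition sphere_tangent :: "complex ^ 'n::finite \<Rightarrow> (complex ^ 'n) set" where
  "sphere_tangent p = {v. p \<bullet> v = 0}"

(* The differential at p of the restriction to the sphere is the restriction to the tangent
   space of the real Frechet derivative, which exists by milnor_map_differentiable.  The rank
   is the real dimension of its image. *)
definition singular_point ::
  "('m::finite \<Rightarrow> 'n::finite cpoly) \<Rightarrow> real \<Rightarrow> complex ^ 'n \<Rightarrow> bool" where
  "singular_point f \<epsilon> p \<longleftrightarrow>
     p \<in> sphere 0 \<epsilon> - link f \<epsilon> \<and>
     dim (frechet_derivative (milnor_map f) (at p) ` sphere_tangent p) < CARD('m)"

(* The branches of log h near p differ by constants, so the gradient of log h is defined by
   (1/h) * dh/dz_k. *)
definition grad_log :: "(complex ^ 'n::finite \<Rightarrow> complex) \<Rightarrow> complex ^ 'n \<Rightarrow> complex ^ 'n" where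
  "grad_log h p = (\<chi> k. cnj (1 / h p * partial_deriv k h p))"

definition dependent_family :: "('m::finite \<Rightarrow> complex ^ 'n::finite) \<Rightarrow> bool" where
  "dependent_family v \<longleftrightarrow>
     (\<exists>c :: 'm \<Rightarrow> complex. (\<exists>j. c j \<noteq> 0) \<and> (\<Sum>j\<in>UNIV. c j *s v j) = 0)"

lemma sphere_tangent_iff:
  fixes p :: "complex ^ 'n::finite"
  assumes "p \<in> sphere 0 \<epsilon>" "\<epsilon> > 0"
  shows "v \<in> sphere_tangent p \<longleftrightarrow>
    (\<exists>\<gamma>. \<gamma> 0 = p \<and> (\<forall>t::real. \<gamma> t \<in> sphere 0 \<epsilon>) \<and> (\<gamma> has_vector_derivative v) (at 0))"
proof
  assume v: "v \<in> sphere_tangent p"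
  define \<gamma> where "\<gamma> t = (\<epsilon> / norm (p + t *\<^sub>R v)) *\<^sub>R (p + t *\<^sub>R v)" for t :: real
  have pv: "p \<bullet> v = 0" using v by (simp add: sphere_tangent_def)
  have np: "norm p = \<epsilon>" using assms by simp
  have sq: "(norm (p + t *\<^sub>R v))\<^sup>2 = \<epsilon>\<^sup>2 + t\<^sup>2 * (norm v)\<^sup>2" for t
    unfolding power2_norm_eq_inner np[symmetric]
    by (simp add: inner_simps pv inner_commute[of v p] power2_eq_square)
  have nz: "p + t *\<^sub>R v \<noteq> 0" for t
  proof
    assume "p + t *\<^sub>R v = 0"
    then have "\<epsilon>\<^sup>2 + t\<^sup>2 * (norm v)\<^sup>2 = 0" using sq[of t] by simp
    then show False using \<open>\<epsilon> > 0\<close>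
      by (metis add_nonneg_eq_0_iff less_irrefl mult_nonneg_nonneg power_eq_0_iff zero_le_power2)
  qed
  have nrm: "norm (p + t *\<^sub>R v) = sqrt (\<epsilon>\<^sup>2 + t\<^sup>2 * (norm v)\<^sup>2)" for t
    by (metis sq norm_ge_zero real_sqrt_unique)
  have geq: "\<gamma> = (\<lambda>t. (\<epsilon> / sqrt (\<epsilon>\<^sup>2 + t\<^sup>2 * (norm v)\<^sup>2)) *\<^sub>R (p + t *\<^sub>R v))"
    by (simp add: \<gamma>_def nrm fun_eq_iff)
  have d: "((\<lambda>t. \<epsilon> / sqrt (\<epsilon>\<^sup>2 + t\<^sup>2 * (norm v)\<^sup>2)) has_real_derivative 0) (at 0)"
    using \<open>\<epsilon> > 0\<close> by (auto intro!: derivative_eq_intros)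
  have d2: "((\<lambda>t. p + t *\<^sub>R v) has_vector_derivative v) (at 0)"
    by (auto intro!: derivative_eq_intros)
  have "(\<gamma> has_vector_derivative v) (at 0)"
    unfolding geq
    using has_vector_derivative_scaleR[OF d d2] \<open>\<epsilon> > 0\<close> by simp
  moreover have "\<gamma> t \<in> sphere 0 \<epsilon>" for t
    using nz[of t] \<open>\<epsilon> > 0\<close> by (simp add: \<gamma>_def)
  moreover have "\<gamma> 0 = p" using np \<open>\<epsilon> > 0\<close> by (simp add: \<gamma>_def)
  ultimately show "\<exists>\<gamma>. \<gamma> 0 = p \<and> (\<forall>t::real. \<gamma> t \<in> sphere 0 \<epsilon>) \<and> (\<gamma> has_vector_derivative v) (at 0)"
    by blast
next
  assume "\<exists>\<gamma>. \<gamma> 0 = p \<and> (\<forall>t::real. \<gamma> t \<in> sphere 0 \<epsilon>) \<and> (\<gamma> has_vector_derivative v) (at 0)"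
  then obtain \<gamma> where g: "\<gamma> 0 = p" "\<And>t::real. \<gamma> t \<in> sphere 0 \<epsilon>"
    and d: "(\<gamma> has_vector_derivative v) (at 0)" by blast
  have "((\<lambda>t. \<gamma> t \<bullet> \<gamma> t) has_derivative (\<lambda>t. \<gamma> 0 \<bullet> (t *\<^sub>R v) + (t *\<^sub>R v) \<bullet> \<gamma> 0)) (at 0)"
    using d unfolding has_vector_derivative_def by (intro has_derivative_inner)
  moreover have "(\<lambda>t. \<gamma> t \<bullet> \<gamma> t) = (\<lambda>t. \<epsilon>\<^sup>2)"
    using g(2) by (simp add: dot_square_norm)
  ultimately have "((\<lambda>t. \<epsilon>\<^sup>2) has_derivative (\<lambda>t. \<gamma> 0 \<bullet> (t *\<^sub>R v) + (t *\<^sub>R v) \<bullet> \<gamma> 0)) (at 0)"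
    by simp
  from has_derivative_unique[OF this has_derivative_const]
  have "p \<bullet> (1 *\<^sub>R v) + (1 *\<^sub>R v) \<bullet> p = 0"
    using g(1) by meson
  then show "v \<in> sphere_tangent p"
    by (simp add: sphere_tangent_def inner_commute)
qed

lemma peval_differentiable: "peval f differentiable (at p)"
proof -
  have nth: "((\<lambda>z::complex ^ 'a. z $ k) has_derivative (\<lambda>h. h $ k)) (at p)" for k
    by (rule bounded_linear.has_derivative[OF bounded_linear_vec_nth has_derivative_ident])
  have "(\<lambda>z. peval f z) differentiable (at p)"
    unfolding peval_def differentiable_def
    by (rule exI, (rule derivative_eq_intros nth refl)+)
  then show ?thesis by simp
qed

lemma milnor_map_differentiable:
  fixes f :: "'m::finite \<Rightarrow> 'n::finite cpoly"
  assumes "p \<in> sphere 0 \<epsilon> - link f \<epsilon>"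
  shows "milnor_map f differentiable (at p)"
proof -
  have nz: "peval (f j) p \<noteq> 0" for j
    using assms by (auto simp: link_def)
  have n: "(\<lambda>z. norm (peval (f j) z)) differentiable (at p)" for j
    by (rule differentiable_compose[OF _ peval_differentiable]) (simp add: differentiable_norm_at nz)
  have lin: "(\<lambda>z. L (g z)) differentiable (at p)"
    if "bounded_linear L" "g differentiable (at p)"
    for L :: "complex \<Rightarrow> complex ^ 'm" and g :: "complex ^ 'n \<Rightarrow> complex"
    using that bounded_linear.has_derivative[OF that(1)] unfolding differentiable_def by blast
  have cn: "(\<lambda>z. complex_of_real (norm (peval (f j) z))) differentiable (at p)" for j
    using bounded_linear.has_derivative[OF bounded_linear_of_real] n[of j]
    unfolding differentiable_def by fast
  have c: "(\<lambda>z. peval (f j) z / of_real (cmod (peval (f j) z))) differentiable (at p)" for j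
    using cn[of j] nz[of j] peval_differentiable[of "f j" p] by (intro differentiable_divide) auto
  have eq: "milnor_map f = (\<lambda>z. \<Sum>j\<in>UNIV. axis j (peval (f j) z / of_real (cmod (peval (f j) z))))"
    by (simp add: milnor_map_def fun_eq_iff vec_eq_iff axis_def if_distrib[of "\<lambda>x. _ $ x"])
  have ax: "bounded_linear (axis j :: complex \<Rightarrow> complex ^ 'm)" for j
    by (rule linear_conv_bounded_linear[THEN iffD1])
       (auto intro!: linearI simp: vec_eq_iff axis_def)
  show ?thesis
    unfolding eq
    using c by (intro differentiable_sum ballI lin[OF ax]) auto
qed

end

theory Submission
  imports Defs
begin

text \<open>
  Write \<open>g\<^sub>j\<close> for the vectors \<open>i grad log f\<^sub>j(p)\<close>. The differential of the \<open>j\<close>-th argument is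
  \<open>v \<mapsto> \<langle>v, g\<^sub>j\<rangle>\<close> for the real inner product. At a singular point some nontrivial real combination
  \<open>\<Sum> c\<^sub>j g\<^sub>j\<close> is therefore normal to the sphere, i.e. equal to \<open>r p\<close> with \<open>r\<close> real. Since the weights
  are multiples \<open>s\<^sub>j w\<close> of one \<open>w\<close>, the single vector \<open>E = (p\<^sub>k / w\<^sub>k)\<close> has real Hermitian product \<open>s\<^sub>j\<close> with every
  \<open>grad log f\<^sub>j(p)\<close>, so its real inner product with every \<open>g\<^sub>j\<close> vanishes. Hence
  \<open>r \<Sum> |p\<^sub>k|\<^sup>2 / w\<^sub>k = 0\<close>, which forces \<open>r = 0\<close>.
\<close>

text \<open>This makes the \<open>deriv\<close> in \<open>partial_deriv\<close> a genuine complex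
  derivative: along a coordinate line a polynomial is entire.\<close>

lemma peval_partial_field_differentiable:
  "(\<lambda>t. peval f (\<chi> i. if i = k then t else z $ i)) field_differentiable (at x)"
proof -
  have "(\<lambda>t. if i = k then t else z $ i) holomorphic_on UNIV" for i
    by (cases "i = k") auto
  then have "(\<lambda>t. peval f (\<chi> i. if i = k then t else z $ i)) holomorphic_on UNIV"
    unfolding peval_def vec_lambda_beta by (intro holomorphic_intros)
  then show ?thesis
    by (rule holomorphic_on_imp_differentiable_at) auto
qed

text \<open>A real-linear \<open>D\<close> is determined by its values on the vectors
  \<open>axis k t\<close>. Along the k-th complex coordinate line, uniqueness of derivatives makes
  \<open>D\<close> agree with multiplication by the complex partial derivative.\<close>

lemma peval_has_derivative:
  fixes p :: "complex ^ 'n::finite"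
  shows "(peval f has_derivative (\<lambda>v. \<Sum>k\<in>UNIV. v $ k * partial_deriv k (peval f) p)) (at p)"
proof -
  obtain D where D: "(peval f has_derivative D) (at p)"
    using peval_differentiable[of f p] by (auto simp: differentiable_def)
  have lin: "linear D"
    using D by (rule has_derivative_linear)
  have partial: "D (axis k t) = t * partial_deriv k (peval f) p" for k t
  proof -
    \<comment> \<open>The line is parametrized by the coordinate itself, as in
      \<open>partial_deriv\<close>, so it meets \<open>p\<close> at
      \<open>t = p $ k\<close>.\<close>
    define l where "l t = (\<chi> i. if i = k then t else p $ i)" for t
    have l_eq: "l t = l 0 + axis k t" for t
      by (auto simp: l_def vec_eq_iff axis_def)
    have "bounded_linear (axis k :: complex \<Rightarrow> complex ^ 'n)"
      by (rule linear_conv_bounded_linear[THEN iffD1])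
         (auto intro!: linearI simp: vec_eq_iff axis_def)
    then have "((\<lambda>t. l 0 + axis k t) has_derivative (\<lambda>t. 0 + axis k t)) (at (p $ k))"
      by (intro has_derivative_add has_derivative_const
          bounded_linear.has_derivative[OF _ has_derivative_ident])
    then have dl: "(l has_derivative axis k) (at (p $ k))"
      by (simp flip: l_eq)
    have lp: "l (p $ k) = p"
      by (simp add: l_def vec_eq_iff)
    have "((\<lambda>t. peval f (l t)) has_derivative (\<lambda>t. D (axis k t))) (at (p $ k))"
      using has_derivative_compose[OF dl] D lp by simp
    moreover have "((\<lambda>t. peval f (l t)) has_derivative (*) (partial_deriv k (peval f) p)) (at (p $ k))"
      unfolding partial_deriv_def l_def has_field_derivative_def[symmetric]
      by (simp add: field_differentiable_derivI peval_partial_field_differentiable)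
    ultimately have "(\<lambda>t. D (axis k t)) = (*) (partial_deriv k (peval f) p)"
      by (rule has_derivative_unique)
    then show ?thesis
      by (simp add: fun_eq_iff mult.commute)
  qed
  have "D v = (\<Sum>k\<in>UNIV. v $ k * partial_deriv k (peval f) p)" for v
  proof -
    have "v = (\<Sum>k\<in>UNIV. axis k (v $ k))"
      by (simp add: vec_eq_iff axis_def if_distrib[of "\<lambda>x. _ $ x"])
    then have "D v = (\<Sum>k\<in>UNIV. D (axis k (v $ k)))"
      by (metis linear_sum[OF lin])
    then show ?thesis
      by (simp add: partial)
  qed
  then have "D = (\<lambda>v. \<Sum>k\<in>UNIV. v $ k * partial_deriv k (peval f) p)"
    by blast
  with D show ?thesis
    by simp
qed

text \<open>The logarithmic derivative \<open>F' v / F p\<close> has the relative change of modulus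
  as real part and the change of argument as imaginary part. Normalizing removes the former; the
  latter moves the value along the unit tangent \<open>\<i> * F p / cmod (F p)\<close> of the
  circle.\<close>

lemma has_derivative_unit_direction:
  fixes F :: "'a::real_normed_vector \<Rightarrow> complex"
  assumes F: "(F has_derivative F') (at p)" and nz: "F p \<noteq> 0"
  shows "((\<lambda>z. F z / of_real (cmod (F z))) has_derivative
           (\<lambda>v. \<i> * (F p / of_real (cmod (F p))) * of_real (Im (F' v / F p)))) (at p)"
proof -
  have "((\<lambda>z. cmod (F z)) has_derivative (\<lambda>v. F' v \<bullet> sgn (F p))) (at p)"
    using has_derivative_compose[OF F has_derivative_norm[OF nz]]
    by (simp add: inner_commute)
  then have "((\<lambda>z. complex_of_real (cmod (F z))) has_derivative
      (\<lambda>v. of_real (F' v \<bullet> sgn (F p)))) (at p)"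
    by (rule has_derivative_of_real)
  from has_derivative_divide[OF F this]
  have D: "((\<lambda>z. F z / of_real (cmod (F z))) has_derivative
      (\<lambda>v. - F p * (inverse (of_real (cmod (F p))) * of_real (F' v \<bullet> sgn (F p)) *
          inverse (of_real (cmod (F p)))) + F' v / of_real (cmod (F p)))) (at p)"
    using nz by simp
  have "- F p * (inverse (of_real (cmod (F p))) * of_real (F' v \<bullet> sgn (F p)) *
          inverse (of_real (cmod (F p)))) + F' v / of_real (cmod (F p))
      = \<i> * (F p / of_real (cmod (F p))) * of_real (Im (F' v / F p))" for v
  proof -
    define q where "q = F' v / F p"
    have F'v: "F' v = q * F p"
      using nz by (simp add: q_def)
    have "(q * F p) \<bullet> F p = Re q * (cmod (F p))\<^sup>2"
      unfolding cmod_power2 by (simp add: inner_complex_def algebra_simps power2_eq_square)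
    then have "F' v \<bullet> sgn (F p) = Re q * cmod (F p)"
      using nz by (simp add: F'v sgn_div_norm power2_eq_square)
    then have "- F p * (inverse (of_real (cmod (F p))) * of_real (F' v \<bullet> sgn (F p)) *
          inverse (of_real (cmod (F p)))) + F' v / of_real (cmod (F p))
      = F p / of_real (cmod (F p)) * (q - of_real (Re q))"
      using nz by (simp add: F'v field_simps)
    also have "q - of_real (Re q) = \<i> * of_real (Im q)"
      by (simp add: complex_eq_iff)
    finally show ?thesis
      by (simp add: q_def mult_ac)
  qed
  with D show ?thesis
    by simp
qed

text \<open>The conjugation in \<open>grad_log\<close> turns the real inner product into the real
  part of a complex-bilinear sum, and the factor \<open>\<i>\<close> turns that into the imaginary
  part. The value is the derivative of arg h in direction \<open>v\<close>.\<close>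

lemma inner_i_grad_log:
  "v \<bullet> (\<i> *s grad_log h p) = Im ((\<Sum>k\<in>UNIV. v $ k * partial_deriv k h p) / h p)"
proof -
  have "x \<bullet> (\<i> * cnj (1 / c * y)) = Im (x * y / c)" for x y c :: complex
  proof -
    have "x \<bullet> (\<i> * cnj u) = Im (x * u)" for u
      by (simp add: inner_complex_def)
    from this[of "1 / c * y"] show ?thesis
      by simp
  qed
  then show ?thesis
    by (simp only: inner_vec_def grad_log_def sum_divide_distrib Im_sum vector_smult_component
        vec_lambda_beta)
qed

lemma frechet_derivative_milnor_map_nth:
  fixes f :: "'m::finite \<Rightarrow> 'n::finite cpoly"
  assumes p: "p \<in> sphere 0 \<epsilon> - link f \<epsilon>"
  shows "frechet_derivative (milnor_map f) (at p) v $ j =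
    \<i> * (peval (f j) p / of_real (cmod (peval (f j) p))) *
      of_real (v \<bullet> (\<i> *s grad_log (peval (f j)) p))"
proof -
  have nz: "peval (f j) p \<noteq> 0"
    using p by (auto simp: link_def)
  have "(milnor_map f has_derivative frechet_derivative (milnor_map f) (at p)) (at p)"
    using milnor_map_differentiable[OF p] by (simp add: frechet_derivative_works)
  then have "((\<lambda>z. milnor_map f z $ j) has_derivative
      (\<lambda>v. frechet_derivative (milnor_map f) (at p) v $ j)) (at p)"
    by (rule bounded_linear.has_derivative[OF bounded_linear_vec_nth])
  moreover have "((\<lambda>z. milnor_map f z $ j) has_derivative
      (\<lambda>v. \<i> * (peval (f j) p / of_real (cmod (peval (f j) p))) *
        of_real (v \<bullet> (\<i> *s grad_log (peval (f j)) p)))) (at p)"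
    unfolding inner_i_grad_log milnor_map_def vec_lambda_beta
    by (rule has_derivative_unit_direction[OF peval_has_derivative nz])
  ultimately show ?thesis
    by (metis has_derivative_unique)
qed

lemma singular_point_imp_normal_combination:
  fixes f :: "'m::finite \<Rightarrow> 'n::finite cpoly"
  assumes "singular_point f \<epsilon> p"
  shows "\<exists>c :: real ^ 'm. \<exists>r::real. c \<noteq> 0 \<and>
    (\<Sum>j\<in>UNIV. c $ j *\<^sub>R (\<i> *s grad_log (peval (f j)) p)) = r *\<^sub>R p"
proof -
  define g where "g j = \<i> *s grad_log (peval (f j)) p" for j
  define L where "L v = (\<chi> j. v \<bullet> g j)" for v
  \<comment> \<open>\<open>R\<close> embeds \<open>real ^ 'm\<close> onto the tangent space of the
    torus at \<open>milnor_map f p\<close>. Being injective, it reduces the rank to that of the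
    argument differentials collected in \<open>L\<close>.\<close>
  define R where "R r = (\<chi> j. \<i> * (peval (f j) p / of_real (cmod (peval (f j) p))) * of_real (r $ j))"
    for r :: "real ^ 'm"
  have p: "p \<in> sphere 0 \<epsilon> - link f \<epsilon>"
    and dim: "dim (frechet_derivative (milnor_map f) (at p) ` sphere_tangent p) < CARD('m)"
    using assms by (auto simp: singular_point_def)
  have nz: "peval (f j) p \<noteq> 0" for j
    using p by (auto simp: link_def)
  have "frechet_derivative (milnor_map f) (at p) v = R (L v)" for v
    by (simp add: vec_eq_iff frechet_derivative_milnor_map_nth[OF p] R_def L_def g_def)
  then have "frechet_derivative (milnor_map f) (at p) ` sphere_tangent p = R ` L ` sphere_tangent p"
    by (simp add: image_image)
  moreover have "linear R"
    by (intro linearI) (simp_all add: R_def vec_eq_iff algebra_simps scaleR_conv_of_real[where 'a = complex] add_divide_distrib)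
  moreover have "inj R"
    using nz by (auto simp: inj_def R_def vec_eq_iff)
  ultimately have "dim (L ` sphere_tangent p) < DIM(real ^ 'm)"
    using dim by (simp add: dim_image_eq inj_on_subset[OF _ subset_UNIV])
  from orthogonal_to_subspace_exists[OF this]
  obtain c where c: "c \<noteq> 0" "\<And>y. y \<in> span (L ` sphere_tangent p) \<Longrightarrow> orthogonal c y"
    by auto
  define G where "G = (\<Sum>j\<in>UNIV. c $ j *\<^sub>R g j)"
  have tangent: "v \<bullet> G = 0" if "p \<bullet> v = 0" for v
  proof -
    have "orthogonal c (L v)"
      using that by (intro c span_base imageI) (simp add: sphere_tangent_def)
    then show ?thesis
      by (simp add: orthogonal_def inner_vec_def[of c] L_def G_def inner_sum_right)
  qed
  \<comment> \<open>\<open>r *\<^sub>R p\<close> is the orthogonal projection of \<open>G\<close> to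
    the real line of \<open>p\<close>. The remainder is tangent, hence orthogonal to both
    \<open>p\<close> and \<open>G\<close>, and so to itself. If \<open>p = 0\<close>, division by
    zero gives \<open>r = 0\<close>, which still fits since every vector is then tangent.\<close>
  define r where "r = (p \<bullet> G) / (p \<bullet> p)"
  have "p \<bullet> (G - r *\<^sub>R p) = 0"
    by (auto simp: r_def inner_diff_right)
  moreover from this have "(G - r *\<^sub>R p) \<bullet> G = 0"
    by (rule tangent)
  ultimately have "(G - r *\<^sub>R p) \<bullet> (G - r *\<^sub>R p) = 0"
    by (simp add: inner_diff_right[of "G - r *\<^sub>R p"] inner_commute[of _ p])
  then have "G = r *\<^sub>R p"
    by simp
  with c(1) show ?thesis
    unfolding G_def g_def by blast
qed

text \<open>Scaling the weights by \<open>s\<close> divides the Euler sum by \<open>s\<close>. Its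
  quotient by the value of \<open>f\<close> is thus the real number \<open>s\<close>, which has no
  imaginary part.\<close>

lemma euler_vector_inner_i_grad_log:
  assumes "weighted_homogeneous f (of_nat s *s w)" and "s > 0" and "peval f p \<noteq> 0"
  shows "(\<chi> k. p $ k / of_rat (w $ k)) \<bullet> (\<i> *s grad_log (peval f) p) = 0"
proof -
  have "peval f p = (\<Sum>k\<in>UNIV. p $ k / of_rat (of_nat s * w $ k) * partial_deriv k (peval f) p)"
    using assms(1) by (simp add: weighted_homogeneous_def)
  also have "\<dots> = (\<Sum>k\<in>UNIV. p $ k / of_rat (w $ k) * partial_deriv k (peval f) p) / of_nat s"
    by (simp add: sum_divide_distrib of_rat_mult mult_ac)
  finally have "(\<Sum>k\<in>UNIV. p $ k / of_rat (w $ k) * partial_deriv k (peval f) p) / peval f p = of_nat s"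
    using assms(2,3) by (simp add: field_simps)
  then show ?thesis
    by (simp add: inner_i_grad_log)
qed

text \<open>The inner product is the sum of \<open>(cmod (p $ k))\<^sup>2 / of_rat (w $ k)\<close>,
  in which some term is positive.\<close>

lemma euler_vector_inner_pos:
  fixes p :: "complex ^ 'n::finite"
  assumes "\<And>k. w $ k > 0" and "p \<noteq> 0"
  shows "(\<chi> k. p $ k / of_rat (w $ k)) \<bullet> p > 0"
proof -
  have eq: "(p $ k / of_rat (w $ k)) \<bullet> p $ k = (cmod (p $ k))\<^sup>2 / of_rat (w $ k)" for k
  proof -
    \<comment> \<open>Passing through the reals lets the division act on real and imaginary parts
      separately.\<close>
    have "(of_rat (w $ k) :: complex) = of_real (of_rat (w $ k))"
      by (cases "w $ k") (simp add: of_rat_rat)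
    then show ?thesis
      by (simp only: inner_complex_def Re_divide_of_real Im_divide_of_real cmod_power2)
         (simp add: power2_eq_square add_divide_distrib)
  qed
  obtain k where "p $ k \<noteq> 0"
    using assms(2) by (auto simp: vec_eq_iff)
  then have "(\<Sum>k\<in>UNIV. (cmod (p $ k))\<^sup>2 / of_rat (w $ k)) > (0::real)"
    using assms(1) by (intro sum_pos2[where i = k]) (auto simp: less_imp_le)
  then show ?thesis
    by (simp add: inner_vec_def eq)
qed

theorem proposition5p3:
  fixes f :: "'m::finite \<Rightarrow> 'n::finite cpoly"
    and w :: "'m \<Rightarrow> rat ^ 'n"
    and s :: "'m \<Rightarrow> nat"
    and one :: 'm
  assumes "2 \<le> CARD('n)"
    and "2 \<le> CARD('m)" and "CARD('m) \<le> 2 * CARD('n) - 1"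
    and "\<And>j. weighted_homogeneous (f j) (w j)"
    and "\<And>j. 0 < s j"
    and "\<And>j. w j = of_nat (s j) *s w one"
  shows "\<exists>\<epsilon>0>0. \<forall>\<epsilon>. 0 < \<epsilon> \<and> \<epsilon> \<le> \<epsilon>0 \<longrightarrow>
           (\<forall>p. singular_point f \<epsilon> p \<longrightarrow>
              dependent_family (\<lambda>j. \<i> *s grad_log (peval (f j)) p))"
proof -
  have "dependent_family (\<lambda>j. \<i> *s grad_log (peval (f j)) p)"
    if "0 < \<epsilon>" and sing: "singular_point f \<epsilon> p" for \<epsilon> p
  proof -
    define E where "E = (\<chi> k. p $ k / of_rat (w one $ k))"
    have "p \<in> sphere 0 \<epsilon>" and nz: "peval (f j) p \<noteq> 0" for j
      using sing by (auto simp: singular_point_def link_def)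
    with \<open>0 < \<epsilon>\<close> have "p \<noteq> 0"
      by auto
    obtain c :: "real ^ 'm" and r where "c \<noteq> 0"
      and comb: "(\<Sum>j\<in>UNIV. c $ j *\<^sub>R (\<i> *s grad_log (peval (f j)) p)) = r *\<^sub>R p"
      using singular_point_imp_normal_combination[OF sing] by blast
    have "weighted_homogeneous (f j) (of_nat (s j) *s w one)" for j
      using assms(4,6) by metis
    then have "E \<bullet> (\<i> *s grad_log (peval (f j)) p) = 0" for j
      unfolding E_def by (rule euler_vector_inner_i_grad_log[OF _ assms(5) nz])
    then have "r * (E \<bullet> p) = 0"
      using arg_cong[OF comb, of "\<lambda>x. E \<bullet> x"] by (simp add: inner_sum_right)
    moreover have "E \<bullet> p > 0"
      unfolding E_def using assms(4)[of one] \<open>p \<noteq> 0\<close>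
      by (intro euler_vector_inner_pos) (simp_all add: weighted_homogeneous_def)
    ultimately have "r = 0"
      by simp
    \<comment> \<open>The combination found has real coefficients; \<open>dependent_family\<close>
      asks for complex ones.\<close>
    moreover have "complex_of_real r *s v = r *\<^sub>R v" for r and v :: "complex ^ 'n"
      by (simp add: vec_eq_iff scaleR_conv_of_real[where 'a = complex])
    ultimately have "(\<Sum>j\<in>UNIV. of_real (c $ j) *s (\<i> *s grad_log (peval (f j)) p)) = 0"
      by (simp only: comb scaleR_zero_left)
    moreover have "\<exists>j. complex_of_real (c $ j) \<noteq> 0"
      using \<open>c \<noteq> 0\<close> by (auto simp: vec_eq_iff)
    ultimately show ?thesis
      unfolding dependent_family_def by (intro exI[of _ "\<lambda>j. of_real (c $ j)"] conjI)
  qed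
  then show ?thesis
    \<comment> \<open>The argument works at every positive radius, so the bound 1 is an arbitrary
      choice.\<close>
    by (intro exI[of _ 1]) auto
qed

end
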